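(* Let $M\ge2$ be an integer and let $(a_k)_{k\in\mathbb Z}$ be a sequence of parameters in $(0,\frac1{2M})$ satisfying $$\max\left\{0,\frac{4M\overline a-1}{4M^2\overline a}\right\}<\underline a\le\overline a<\frac1{2M},\qquad \underline a=\inf_{k\in\mathbb Z}a_k,\quad \overline a=\sup_{k\in\mathbb Z}a_k.$$ There exist constants $\lambda>1$, $\delta_\#>0$, $A>0$, $A'>0$ depending only on $M,\overline a,\underline a$, and a sequence $(\mathcal P_k,R_k)_{k\in\mathbb Z}$ such that the following hold: (a) $\mathcal P_k$ is a countable Borel partition of a subset $X_k=\bigcup_{W\in\mathcal P_k}W$ of $\mathrm{int}(X)$ such that $m(W)>0$ for all $W\in\mathcal P_k$ and $m(\mathrm{int}(X)\setminus X_k)=0$; (b) $R_k\colon X\to[2,\infty]$ is a function that is constant on each $W\in\mathcal P_k$ with value $R_k(W)\in\{2,3,\dots\}$; (c) for all $W\in\mathcal P_k$, the map $F_W\colon x\in W\mapsto T_{k,k+R_k(W)-1}(x)\in X$ is affine, $F_W(W)=\mathrm{int}(X)$, and $|F_W(x)-F_W(x')|\ge\lambda|x-x'|$ for all $x,x'\in W$; (d) for all $W\in\mathcal P_k$ and $x,x'\in W$, $$\max_{0\le j\le R_k(W)}|T_{k,k+j-1}(x)-T_{k,k+j-1}(x')|\le|F_W(x)-F_W(x')|;$$ (e) $\inf_{k\in\mathbb Z}m(R_k=2)\ge\delta_\#$ and $\inf_{k\in\mathbb Z}m(R_k=3)\ge\delta_\#$; (f) for all $n\ge1$, $m(R_k\ge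 n)\le A\exp(-A'n)$.
   Context: Heterochaos baker map. Let $X=[0,1]^2$ with coordinates $(x_u,x_c)$ and let $m$ be the Lebesgue measure on $X$; $\mathrm{int}(X)=(0,1)^2$ is the interior in $\mathbb R^2$. For $a\in(0,\frac1M)$ define $\tau_a\colon[0,1]\to[0,1]$ by $\tau_a(x_u)=\frac{x_u-(i-1)a}{a}$ on $[(i-1)a,ia)$, $i=1,\dots,M$, and $\tau_a(x_u)=\frac{x_u-Ma}{1-Ma}$ on $[Ma,1]$. Put $\Omega_a(\alpha_i)=[(i-1)a,ia)\times[0,1]$ for $i=1,\dots,M$, $\Omega_a(\beta_i)=[Ma,1]\times[\frac{i-1}M,\frac iM)$ for $i=1,\dots,M-1$, and $\Omega_a(\beta_M)=[Ma,1]\times[\frac{M-1}M,1]$. Define $f_a\colon X\to X$ by $f_a(x_u,x_c)=(\tau_a(x_u),\frac{x_c}M+\frac{i-1}M)$ on $\Omega_a(\alpha_i)$ and $f_a(x_u,x_c)=(\tau_a(x_u),Mx_c-i+1)$ on $\Omega_a(\beta_i)$, $i=1,\dots,M$. For $k\le\ell$ in $\mathbb Z$ write $T_k=f_{a_k}$, $T_{k,\ell}=T_\ell\circ\cdots\circ T_k$, and set $T_{k,k-1}=\mathrm{id}_X$. $|\cdot|$ is the Euclidean norm. Properties (a)–(d) and (f) are for every $k\in\mathbb Z$. *)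

theory Defs
  imports "HOL-Analysis.Analysis"
begin

text \<open>The norm on \<^typ>\<open>real \<times> real\<close> is the Euclidean norm. Points are pairs \<open>(x\<^sub>u, x\<^sub>c)\<close>.\<close>

definition unit_square :: "(real \<times> real) set" where
  "unit_square = {0..1} \<times> {0..1}"

text \<open>The completed Lebesgue measure on the square. Completeness matters: a function that is
  constant on each element of a countable Borel partition modulo a null set is measurable with
  respect to it, whatever its values on the null set.\<close>

abbreviation square_measure :: "(real \<times> real) measure" where
  "square_measure \<equiv> lebesgue_on unit_square"

definition tau :: "nat \<Rightarrow> real \<Rightarrow> real \<Rightarrow> real" where
  "tau M a x =
    (if \<exists>i\<in>{1..M}. x \<in> {(real i - 1) * a ..< real i * a}
     then (x - (real (THE i. i \<in> {1..M} \<and> x \<in> {(real i - 1) * a ..< real i * a}) - 1) * a) / a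
     else (x - real M * a) / (1 - real M * a))"

definition Omega_alpha :: "real \<Rightarrow> nat \<Rightarrow> (real \<times> real) set" where
  "Omega_alpha a i = {(real i - 1) * a ..< real i * a} \<times> {0..1}"

definition Omega_beta :: "nat \<Rightarrow> real \<Rightarrow> nat \<Rightarrow> (real \<times> real) set" where
  "Omega_beta M a i = {real M * a .. 1} \<times>
     (if i < M then {(real i - 1) / real M ..< real i / real M} else {(real M - 1) / real M .. 1})"

text \<open>Only the values on \<^const>\<open>unit_square\<close> are meaningful; there, for \<open>0 < a < 1/M\<close>, the
  sets \<open>\<Omega>(\<alpha>\<^sub>i)\<close>, \<open>\<Omega>(\<beta>\<^sub>i)\<close> with \<open>1 \<le> i \<le> M\<close> form a partition, so the index picked by
  \<open>THE\<close> is well defined (see \<open>baker_alpha\<close> and \<open>baker_beta\<close> below).\<close>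

definition baker :: "nat \<Rightarrow> real \<Rightarrow> real \<times> real \<Rightarrow> real \<times> real" where
  "baker M a p =
    (if \<exists>i\<in>{1..M}. p \<in> Omega_alpha a i
     then (let i = (THE i. i \<in> {1..M} \<and> p \<in> Omega_alpha a i)
           in (tau M a (fst p), snd p / real M + (real i - 1) / real M))
     else (let i = (THE i. i \<in> {1..M} \<and> p \<in> Omega_beta M a i)
           in (tau M a (fst p), real M * snd p - real i + 1)))"

primrec baker_iter :: "nat \<Rightarrow> (int \<Rightarrow> real) \<Rightarrow> int \<Rightarrow> nat \<Rightarrow> real \<times> real \<Rightarrow> real \<times> real" where
  "baker_iter M a k 0 = id"
| "baker_iter M a k (Suc n) = baker M (a (k + int n)) \<circ> baker_iter M a k n"

text \<open>\<open>T\<^bsub>k,l\<^esub> = T\<^sub>l \<circ> \<dots> \<circ> T\<^sub>k\<close>, a composition of \<open>l - k + 1\<close> maps;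
  in particular \<open>T\<^bsub>k,k-1\<^esub>\<close> is the identity.\<close>

definition baker_comp :: "nat \<Rightarrow> (int \<Rightarrow> real) \<Rightarrow> int \<Rightarrow> int \<Rightarrow> real \<times> real \<Rightarrow> real \<times> real" where
  "baker_comp M a k l = baker_iter M a k (nat (l - k + 1))"

text \<open>A map on a subset of the plane is affine if it is the restriction of an affine map.\<close>

definition affine_map_on :: "(real \<times> real) set \<Rightarrow> (real \<times> real \<Rightarrow> real \<times> real) \<Rightarrow> bool" where
  "affine_map_on W F \<longleftrightarrow> (\<exists>L c. linear L \<and> (\<forall>x\<in>W. F x = L x + c))"

text \<open>The number \<open>R(W)\<close>, for \<open>R\<close> constant with a natural number as its value on a nonempty \<open>W\<close>.\<close>

definition const_value :: "(real \<times> real \<Rightarrow> ereal) \<Rightarrow> (real \<times> real) set \<Rightarrow> nat" where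
  "const_value R W = (THE n::nat. \<forall>x\<in>W. R x = ereal (real n))"

lemma interval_index_unique:
  fixes a x :: real and i j :: nat
  assumes "0 < a" "x \<in> {(real i - 1) * a ..< real i * a}" "x \<in> {(real j - 1) * a ..< real j * a}"
  shows "i = j"
proof -
  have "(real i - 1) * a < real j * a" "(real j - 1) * a < real i * a"
    using assms(2,3) by (auto intro: le_less_trans)
  then have "real i - 1 < real j" "real j - 1 < real i"
    using \<open>0 < a\<close> by (simp_all only: mult_less_cancel_right_pos)
  then show ?thesis by linarith
qed

lemma tau_alpha:
  assumes "0 < a" "i \<in> {1..M}" "x \<in> {(real i - 1) * a ..< real i * a}"
  shows "tau M a x = (x - (real i - 1) * a) / a"
proof -
  have "(THE j. j \<in> {1..M} \<and> x \<in> {(real j - 1) * a ..< real j * a}) = i"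
    using assms interval_index_unique by (intro the_equality) blast+
  then show ?thesis using assms unfolding tau_def by auto
qed

lemma not_alpha:
  assumes "0 < a" "real M * a \<le> x" "i \<in> {1..M}"
  shows "x \<notin> {(real i - 1) * a ..< real i * a}"
proof -
  have "real i * a \<le> real M * a"
    using assms by (intro mult_right_mono) auto
  then have "real i * a \<le> x" using assms(2) by linarith
  then show ?thesis by simp
qed

lemma tau_beta:
  assumes "0 < a" "x \<in> {real M * a .. 1}"
  shows "tau M a x = (x - real M * a) / (1 - real M * a)"
  using assms not_alpha[of a M x] unfolding tau_def by auto

lemma baker_alpha:
  assumes "0 < a" "i \<in> {1..M}" "(xu, xc) \<in> Omega_alpha a i"
  shows "baker M a (xu, xc) = (tau M a xu, xc / real M + (real i - 1) / real M)"
proof -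
  have "(THE j. j \<in> {1..M} \<and> (xu, xc) \<in> Omega_alpha a j) = i"
    using assms interval_index_unique unfolding Omega_alpha_def by (intro the_equality) blast+
  then show ?thesis using assms unfolding baker_def by (auto simp: Let_def)
qed

lemma Omega_beta_unique:
  assumes "i \<in> {1..M}" "j \<in> {1..M}" "p \<in> Omega_beta M a i" "p \<in> Omega_beta M a j"
  shows "i = j"
proof -
  have *: "\<not> r < s" if "r \<in> {1..M}" "s \<in> {1..M}" "p \<in> Omega_beta M a r" "p \<in> Omega_beta M a s"
    for r s :: nat
  proof
    assume "r < s"
    then have "r < M" using that by auto
    then have 1: "snd p < real r / real M"
      using that unfolding Omega_beta_def by auto
    have 2: "(real s - 1) / real M \<le> snd p"
      using that unfolding Omega_beta_def by (cases "s < M") (auto simp: not_less)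
    have "real r / real M \<le> (real s - 1) / real M"
      using \<open>r < s\<close> by (intro divide_right_mono) auto
    then show False using 1 2 by linarith
  qed
  show ?thesis using *[of i j] *[of j i] assms by (meson linorder_neqE_nat)
qed

lemma baker_beta:
  assumes "0 < a" "i \<in> {1..M}" "(xu, xc) \<in> Omega_beta M a i"
  shows "baker M a (xu, xc) = (tau M a xu, real M * xc - real i + 1)"
proof -
  have "\<not> (\<exists>j\<in>{1..M}. (xu, xc) \<in> Omega_alpha a j)"
    using assms not_alpha[of a M xu] unfolding Omega_alpha_def Omega_beta_def by auto
  moreover have "(THE j. j \<in> {1..M} \<and> (xu, xc) \<in> Omega_beta M a j) = i"
    using assms Omega_beta_unique by (intro the_equality) blast+
  ultimately show ?thesis unfolding baker_def by (auto simp: Let_def)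
qed

end

(* Code the expanding coordinate by letters alpha_1, ..., alpha_M, beta and the central one by its
   base-M digits. An alpha_i pushes the digit i - 1 onto the digit string, a beta pops the top digit.
   Let the height of a word be its number of betas minus its number of alphas, and let R be the
   first time n >= 2 at which the height is positive. Up to then at most as many digits are popped
   as the final height d (which is 1 or 2), and everything pushed has been popped again. So fixing
   the word and the first d digits gives an open rectangle mapped affinely onto the open square,
   with central expansion M^d >= 2. At time j the central distances have grown by M^(height at j),
   at most M^d, and the distances in the expanding coordinate never shrink: this is (d).
   The words beta beta and alpha_1 beta beta give R = 2 and R = 3. The letters are independent under
   Lebesgue measure and alphas have probability M a_k <= M a_sup < 1/2, so the height drifts
   upwards and a Chernoff bound gives the exponential tail of R. *)

theory Submission
  imports Defs
begin

section \<open>Interval codings\<close>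

text \<open>At each time \<open>k\<close> the unit interval is cut into \<open>N\<close> consecutive
  pieces with left ends \<open>off k s\<close> and lengths \<open>wid k s\<close>;
  \<open>off k N\<close> is the right end of the last one. Two instances follow: a time-dependent
  one for the expanding coordinate and the base-M digits for the central one.\<close>

locale interval_coding =
  fixes N :: nat and off wid :: "int \<Rightarrow> nat \<Rightarrow> real"
  assumes wid_pos: "\<And>k s. s < N \<Longrightarrow> 0 < wid k s"
    and off_0: "\<And>k. off k 0 = 0"
    and off_Suc: "\<And>k s. s < N \<Longrightarrow> off k (Suc s) = off k s + wid k s"
    and off_N: "\<And>k. off k N = 1"
begin

text \<open>A composition of inverse branches: the first letter acts outermost, at time
  \<open>k\<close>, and \<open>v\<close> is the position reached once all of \<open>w\<close> has
  been read.\<close>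

primrec point :: "nat list \<Rightarrow> int \<Rightarrow> real \<Rightarrow> real" where
  "point [] k v = v"
| "point (s # w) k v = off k s + wid k s * point w (k + 1) v"

primrec width :: "nat list \<Rightarrow> int \<Rightarrow> real" where
  "width [] k = 1"
| "width (s # w) k = wid k s * width w (k + 1)"

text \<open>Open cylinders make disjointness immediate and stay clear of the half-open conventions
  in the map; the price is the finite set \<open>bad\<close> of missed endpoints.\<close>

definition cyl :: "nat list \<Rightarrow> int \<Rightarrow> real set" where
  "cyl w k = point w k ` {0<..<1}"

definition wordset :: "nat \<Rightarrow> nat list set" where
  "wordset n = {w. set w \<subseteq> {..<N} \<and> length w = n}"

lemma finite_wordset: "finite (wordset n)"
  unfolding wordset_def by (rule finite_lists_length_eq) simp

lemma wordset_0: "wordset 0 = {[]}"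
  by (auto simp: wordset_def)

lemma wordset_Suc: "wordset (Suc n) = (\<lambda>(s, w). s # w) ` ({..<N} \<times> wordset n)"
proof (intro equalityI subsetI)
  fix w assume "w \<in> wordset (Suc n)"
  then show "w \<in> (\<lambda>(s, w). s # w) ` ({..<N} \<times> wordset n)"
    by (cases w) (auto simp: wordset_def)
qed (auto simp: wordset_def)

lemma sum_wordset_Suc:
  "(\<Sum>w\<in>wordset (Suc n). g w) = (\<Sum>s<N. \<Sum>w\<in>wordset n. (g (s # w) :: real))"
proof -
  have "inj_on (\<lambda>(s, w). s # w) ({..<N} \<times> wordset n)"
    by (auto simp: inj_on_def)
  then show ?thesis
    unfolding wordset_Suc by (simp add: sum.reindex sum.cartesian_product case_prod_unfold)
qed

lemma point_affine: "point w k v = point w k 0 + width w k * v"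
proof (induction w arbitrary: k)
  case (Cons s w)
  show ?case using Cons[of "k + 1"] by (simp add: algebra_simps)
qed simp

lemma point_append: "point (w @ w') k v = point w k (point w' (k + int (length w)) v)"
proof (induction w arbitrary: k)
  case (Cons s w)
  have "k + int (length (s # w)) = (k + 1) + int (length w)" by simp
  then show ?case using Cons[of "k + 1"] by (metis append_Cons point.simps(2))
qed simp

lemma width_pos: "set w \<subseteq> {..<N} \<Longrightarrow> 0 < width w k"
  by (induction w arbitrary: k) (auto simp: wid_pos)

lemma off_mono:
  assumes "s \<le> t" "t \<le> N"
  shows "off k s \<le> off k t"
  using assms
proof (induction t)
  case (Suc t)
  have less: "off k t < off k (Suc t)"
    using off_Suc[of t k] wid_pos[of t k] Suc.prems by simp
  show ?case
  proof (cases "s = Suc t")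
    case False
    then have "off k s \<le> off k t" using Suc by simp
    then show ?thesis using less by simp
  qed simp
qed simp

lemma off_nonneg: "s \<le> N \<Longrightarrow> 0 \<le> off k s"
  using off_mono[of 0 s k] off_0 by simp

lemma branch_le_1: "s < N \<Longrightarrow> off k s + wid k s \<le> 1"
  using off_mono[of "Suc s" N k] off_N off_Suc by simp

lemma wid_le_1: "s < N \<Longrightarrow> wid k s \<le> 1"
  using branch_le_1[of s k] off_nonneg[of s k] by simp

lemma branch_unique:
  assumes "s < N" "t < N"
    and "off k s < x" "x < off k s + wid k s" "off k t < x" "x < off k t + wid k t"
  shows "s = t"
proof -
  have *: False if "s < t" "t < N" "x < off k s + wid k s" "off k t < x" for s t
    using off_mono[of "Suc s" t k] off_Suc[of s k] that by simp
  show ?thesis using *[of s t] *[of t s] assms by (meson linorder_neqE_nat)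
qed

lemma point_in:
  assumes "set w \<subseteq> {..<N}" "0 < v" "v < 1"
  shows "0 < point w k v \<and> point w k v < 1"
  using assms(1)
proof (induction w arbitrary: k)
  case (Cons s w)
  then have s: "s < N" and IH: "0 < point w (k + 1) v" "point w (k + 1) v < 1" by auto
  have "0 < wid k s * point w (k + 1) v" "wid k s * point w (k + 1) v < wid k s"
    using IH wid_pos[OF s] by auto
  then show ?case using off_nonneg[of s k] branch_le_1[OF s, of k] s by simp
qed (use assms in auto)

lemma cyl_subset: "set w \<subseteq> {..<N} \<Longrightarrow> cyl w k \<subseteq> {0<..<1}"
  using point_in by (auto simp: cyl_def)

lemma cyl_eq:
  assumes "set w \<subseteq> {..<N}"
  shows "cyl w k = {point w k 0 <..< point w k 0 + width w k}"
proof -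
  have "x \<in> cyl w k" if "x \<in> {point w k 0 <..< point w k 0 + width w k}" for x
  proof -
    have "x = point w k ((x - point w k 0) / width w k)"
      using width_pos[OF assms, of k] by (subst point_affine) simp
    moreover have "(x - point w k 0) / width w k \<in> {0<..<1}"
      using that width_pos[OF assms, of k] by (auto simp: field_simps)
    ultimately show ?thesis unfolding cyl_def by blast
  qed
  moreover have "x \<in> {point w k 0 <..< point w k 0 + width w k}" if x: "x \<in> cyl w k" for x
  proof -
    obtain v where v: "0 < v" "v < 1" "x = point w k v"
      using x unfolding cyl_def by auto
    have "x = point w k 0 + width w k * v" unfolding v(3) by (rule point_affine)
    then show ?thesis using v(1,2) width_pos[OF assms, of k] by simp
  qed
  ultimately show ?thesis by blast
qed

lemma cyl_nonempty: "cyl w k \<noteq> {}"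
  by (simp add: cyl_def)

lemma open_cyl: "set w \<subseteq> {..<N} \<Longrightarrow> open (cyl w k)"
  by (simp add: cyl_eq)

lemma measure_cyl: "set w \<subseteq> {..<N} \<Longrightarrow> measure lborel (cyl w k) = width w k"
  using width_pos[of w k] by (simp add: cyl_eq)

section \<open>Cylinders and prefixes\<close>

lemma cyl_take:
  assumes "set w \<subseteq> {..<N}"
  shows "cyl w k \<subseteq> cyl (take j w) k"
proof
  fix x assume "x \<in> cyl w k"
  then obtain v where v: "0 < v" "v < 1" "x = point w k v" by (auto simp: cyl_def)
  let ?v' = "point (drop j w) (k + int (length (take j w))) v"
  have "set (drop j w) \<subseteq> {..<N}" using assms by (rule order_trans[OF set_drop_subset])
  then have "?v' \<in> {0<..<1}" using point_in v by auto
  moreover have "x = point (take j w) k ?v'"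
    using v by (metis append_take_drop_id point_append)
  ultimately show "x \<in> cyl (take j w) k" unfolding cyl_def by blast
qed

text \<open>The open branches at one time are disjoint, so a common point forces equal first
  letters; cancelling that affine branch leaves a common point of the tails one time later.\<close>

lemma cyl_prefix:
  assumes "set w \<subseteq> {..<N}" "set w' \<subseteq> {..<N}" "x \<in> cyl w k" "x \<in> cyl w' k"
    and "length w \<le> length w'"
  shows "w = take (length w) w'"
  using assms
proof (induction w arbitrary: w' x k)
  case (Cons s v)
  obtain s' v' where w': "w' = s' # v'"
    using Cons.prems(5) by (cases w') auto
  obtain t where t: "t \<in> {0<..<1}" "x = off k s + wid k s * point v (k + 1) t"
    using Cons.prems(3) by (auto simp: cyl_def)
  obtain t' where t': "t' \<in> {0<..<1}" "x = off k s' + wid k s' * point v' (k + 1) t'"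
    using Cons.prems(4) w' by (auto simp: cyl_def)
  have s: "s < N" "s' < N" and sub: "set v \<subseteq> {..<N}" "set v' \<subseteq> {..<N}"
    using Cons.prems w' by auto
  have pos: "0 < wid k s" "0 < wid k s'" using s wid_pos by auto
  have "0 < wid k s * point v (k + 1) t" "wid k s * point v (k + 1) t < wid k s"
    using pos t point_in[OF sub(1), of t "k + 1"] by auto
  moreover have "0 < wid k s' * point v' (k + 1) t'" "wid k s' * point v' (k + 1) t' < wid k s'"
    using pos t' point_in[OF sub(2), of t' "k + 1"] by auto
  ultimately have "s = s'"
    using branch_unique[OF s, of k x] t t' by linarith
  then have "point v (k + 1) t = point v' (k + 1) t'"
    using t t' pos by simp
  then have "point v (k + 1) t \<in> cyl v (k + 1)" "point v (k + 1) t \<in> cyl v' (k + 1)"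
    using t(1) t'(1) unfolding cyl_def by (metis imageI)+
  then have "v = take (length v) v'"
    using Cons.IH[OF sub] Cons.prems(5) w' by simp
  then show ?case using \<open>s = s'\<close> w' by simp
qed simp

lemma cyl_length_unique:
  assumes "set w \<subseteq> {..<N}" "set w' \<subseteq> {..<N}" "x \<in> cyl w k" "x \<in> cyl w' k"
    and "length w = length w'"
  shows "w = w'"
  using cyl_prefix[OF assms(1-4)] assms(5) by simp

section \<open>Points outside all cylinders of a given length\<close>

lemma branch_cover:
  assumes "0 \<le> x" "x \<le> off k n" "n \<le> N" "x \<notin> off k ` {..n}"
  shows "\<exists>s<n. off k s < x \<and> x < off k s + wid k s"
  using assms
proof (induction n)
  case (Suc n)
  have ne: "x \<noteq> off k n" "x \<noteq> off k (Suc n)"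
    using Suc.prems(4) by (metis atMost_iff image_eqI le_SucI order_refl)+
  have eq: "off k (Suc n) = off k n + wid k n"
    using Suc.prems(3) off_Suc[of n k] by simp
  show ?case
  proof (cases "x < off k n")
    case True
    have "x \<notin> off k ` {..n}" using Suc.prems(4) by (auto simp: atMost_Suc)
    then have "\<exists>s<n. off k s < x \<and> x < off k s + wid k s"
      using Suc.IH Suc.prems(1,3) True by simp
    then show ?thesis using less_SucI by blast
  next
    case False
    then show ?thesis
      using Suc.prems(2) ne eq by (intro exI[of _ n]) simp
  qed
qed (simp add: off_0)

definition bad :: "nat \<Rightarrow> int \<Rightarrow> real set" where
  "bad n k = {0..1} - (\<Union>w\<in>wordset n. cyl w k)"

text \<open>A point missed at depth n + 1 is a branch endpoint or the image, under one of finitely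
  many branches, of a point missed at depth n one time later.\<close>

lemma finite_bad: "finite (bad n k)"
proof (induction n arbitrary: k)
  case 0
  have "bad 0 k \<subseteq> {0, 1}"
    by (auto simp: bad_def wordset_0 cyl_def)
  then show ?case by (rule finite_subset) simp
next
  case (Suc n)
  have "x \<in> off k ` {..N} \<union> (\<Union>s\<in>{..<N}. (\<lambda>v. off k s + wid k s * v) ` bad n (k + 1))"
    if x: "x \<in> bad (Suc n) k" and nx: "x \<notin> off k ` {..N}" for x
  proof -
    obtain s where s: "s < N" "off k s < x" "x < off k s + wid k s"
      using branch_cover[of x k N] x nx off_N by (auto simp: bad_def)
    let ?v = "(x - off k s) / wid k s"
    have xv: "x = off k s + wid k s * ?v" using wid_pos[OF s(1), of k] by simp
    have "?v \<notin> cyl w (k + 1)" if "w \<in> wordset n" for w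
    proof
      assume "?v \<in> cyl w (k + 1)"
      then obtain t where "t \<in> {0<..<1}" "?v = point w (k + 1) t" by (auto simp: cyl_def)
      then have "x \<in> cyl (s # w) k"
        using xv unfolding cyl_def by (intro image_eqI[of _ _ t]) auto
      moreover have "s # w \<in> wordset (Suc n)" using that s by (auto simp: wordset_def)
      ultimately show False using x by (auto simp: bad_def)
    qed
    moreover have "?v \<in> {0..1}" using s wid_pos[OF s(1), of k] by (auto simp: field_simps)
    ultimately have "?v \<in> bad n (k + 1)" by (auto simp: bad_def)
    then show ?thesis using xv s(1) by blast
  qed
  then have "bad (Suc n) k \<subseteq>
      off k ` {..N} \<union> (\<Union>s\<in>{..<N}. (\<lambda>v. off k s + wid k s * v) ` bad n (k + 1))"
    by blast
  then show ?case by (rule finite_subset) (use Suc in auto)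
qed

end

section \<open>Rectangles in the square\<close>

text \<open>On Borel sets the completed measure agrees with \<open>lborel\<close>, which in the
  plane is a product measure. Areas of rectangles thus reduce to lengths of cylinders.\<close>

lemma measure_square_Times:
  assumes "A \<in> sets borel" "B \<in> sets borel" "A \<subseteq> {0..1}" "B \<subseteq> {0..1}"
  shows "A \<times> B \<in> sets square_measure"
    and "measure square_measure (A \<times> B) = measure lborel A * measure lborel B"
proof -
  have AB: "A \<times> B \<in> sets borel" using assms by (intro borel_Times)
  have sub: "A \<times> B \<subseteq> unit_square" using assms by (auto simp: unit_square_def)
  have sq: "unit_square \<in> sets lebesgue"
    unfolding unit_square_def using borel_Times[of "{0..1::real}" "{0..1::real}"] by simp
  show "A \<times> B \<in> sets square_measure"
    using AB sub sq by (subst sets_restrict_space_iff) auto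
  have "measure square_measure (A \<times> B) = measure lborel (A \<times> B)"
    using AB sub sq by (simp add: measure_restrict_space)
  also have "\<dots> = measure (lborel \<Otimes>\<^sub>M lborel) (A \<times> B)" by (simp add: lborel_prod)
  also have "\<dots> = measure lborel A * measure lborel B"
    using assms by (simp add: measure_def lborel.emeasure_pair_measure_Times enn2real_mult)
  finally show "measure square_measure (A \<times> B) = measure lborel A * measure lborel B" .
qed

lemma finite_measure_square: "finite_measure square_measure"
proof
  have eq: "unit_square = cbox (0, 0) (1, 1)"
    by (simp add: unit_square_def cbox_Pair_eq)
  have "emeasure square_measure (space square_measure) = emeasure lebesgue unit_square"
    unfolding eq by (subst emeasure_restrict_space) auto
  also have "\<dots> = emeasure lborel (cbox (0, 0) (1, 1) :: (real \<times> real) set)"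
    unfolding eq by simp
  also have "\<dots> < \<infinity>" by (rule emeasure_lborel_cbox_finite)
  finally show "emeasure square_measure (space square_measure) \<noteq> \<infinity>" by simp
qed

lemma measure_square_le_1: "measure square_measure A \<le> 1"
proof -
  have "measure square_measure A \<le> measure square_measure (space square_measure)"
    by (rule finite_measure.bounded_measure[OF finite_measure_square])
  also have "space square_measure = {0..1} \<times> {0..1}" by (simp add: unit_square_def)
  also have "measure square_measure ({0..1} \<times> {0..1}) = 1"
    by (subst measure_square_Times(2)) auto
  finally show ?thesis .
qed

lemma norm_diff_sqr_prod:
  "(norm (x - x' :: real \<times> real))\<^sup>2 = (fst x - fst x')\<^sup>2 + (snd x - snd x')\<^sup>2"
  by (cases x; cases x') (simp add: norm_Pair)

lemma interior_unit_square: "interior unit_square = {0<..<1} \<times> {0<..<1}"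
  by (simp add: unit_square_def interior_Times)

text \<open>\<open>baker_iter\<close> adds new maps on the outside, whereas words are consumed from
  the first letter; induction on words needs the first map split off.\<close>

lemma baker_iter_Suc_left:
  "baker_iter M a k (Suc n) x = baker_iter M a (k + 1) n (baker M (a k) x)"
proof (induction n)
  case (Suc n)
  have "k + int (Suc n) = (k + 1) + int n" by simp
  then show ?case using Suc by (metis baker_iter.simps(2) comp_apply)
qed simp

section \<open>Words and heights\<close>

text \<open>In the expanding coordinate the symbol \<open>s < M\<close> stands for \<open>\<alpha>\<^bsub>s+1\<^esub>\<close>, and the symbol
  \<open>M\<close> for the union of all \<open>\<beta>\<^sub>i\<close>; the digit \<open>d < M\<close> of the central coordinate stands for
  the strip \<open>[d/M, (d+1)/M)\<close>.\<close>

locale heterochaos =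
  fixes M :: nat and a :: "int \<Rightarrow> real" and p q :: real
  assumes M_ge_2: "2 \<le> M" and p_pos: "0 < p" and q_less: "q < 1 / (2 * real M)"
    and a_ge: "\<And>k. p \<le> a k" and a_le: "\<And>k. a k \<le> q"
begin

lemma M_pos: "0 < real M"
  using M_ge_2 by simp

lemma a_pos: "0 < a k"
  using p_pos a_ge[of k] by simp

lemma Mq_less: "real M * q < 1 / 2"
  using q_less M_pos by (simp add: field_simps)

lemma Ma_le: "real M * a k \<le> real M * q"
  using a_le[of k] M_pos by simp

lemma Ma_ge: "real M * p \<le> real M * a k"
  using a_ge[of k] M_pos by simp

text \<open>The offset is given by cases because the last letter \<open>M\<close> has length 1 - M
  a_k instead of a_k, so that the right end, at index M + 1, is 1.\<close>

sublocale u: interval_coding "Suc M" "\<lambda>k s. if s \<le> M then real s * a k else 1"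
    "\<lambda>k s. if s < M then a k else 1 - real M * a k"
proof
  fix k :: int and s :: nat
  assume "s < Suc M"
  then show "0 < (if s < M then a k else 1 - real M * a k)"
    using a_pos[of k] Ma_le[of k] Mq_less by simp
  show "(if Suc s \<le> M then real (Suc s) * a k else 1) =
      (if s \<le> M then real s * a k else 1) + (if s < M then a k else 1 - real M * a k)"
    using \<open>s < Suc M\<close> by (auto simp: algebra_simps less_Suc_eq)
qed auto

sublocale c: interval_coding M "\<lambda>k d. real d / real M" "\<lambda>k d. 1 / real M"
  using M_pos by unfold_locales (auto simp: field_simps)

text \<open>The digit intervals are the same at all times. Central codes are therefore always taken
  at time 0, and this lemma undoes the shift made by the recursion of \<open>point\<close>.\<close>

lemma c_point_cong: "c.point ds k v = c.point ds l v"
  by (induction ds arbitrary: k l) (simp, metis c.point.simps(2))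

lemma c_width: "c.width ds k = 1 / real M ^ length ds"
  by (induction ds arbitrary: k) auto

primrec height :: "nat list \<Rightarrow> int" where
  "height [] = 0"
| "height (s # w) = (if s < M then - 1 else 1) + height w"

text \<open>Reading \<open>w\<close> pushes a digit at each \<open>\<alpha>\<close> and pops one at each \<open>\<beta>\<close>; started with
  \<open>n\<close> digits, no pop fails and the stack is empty at the end.\<close>

definition clears :: "nat list \<Rightarrow> nat \<Rightarrow> bool" where
  "clears w n \<longleftrightarrow> height w = int n \<and> (\<forall>j\<le>length w. height (take j w) \<le> int n)"

lemma clears_take: "clears w n \<Longrightarrow> j \<le> length w \<Longrightarrow> height (take j w) \<le> int n"
  by (simp add: clears_def)

lemma clears_push:
  assumes "clears (s # w) n" "s < M"
  shows "clears w (Suc n)"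
proof -
  have "height (take j w) \<le> int (Suc n)" if "j \<le> length w" for j
    using clears_take[OF assms(1), of "Suc j"] assms(2) that by simp
  then show ?thesis using assms unfolding clears_def by simp
qed

lemma clears_pop:
  assumes "clears (s # w) n" "\<not> s < M"
  shows "\<exists>m. n = Suc m \<and> clears w m"
proof -
  have *: "height (take j w) + 1 \<le> int n" if "j \<le> length w" for j
    using clears_take[OF assms(1), of "Suc j"] assms(2) that by simp
  \<comment> \<open>The empty prefix of \<open>w\<close> already gives height 1 after the beta, so
    the stack held a digit to pop.\<close>
  have "n \<noteq> 0" using *[of 0] by simp
  then obtain m where "n = Suc m" using not0_implies_Suc by blast
  then show ?thesis using * assms unfolding clears_def by fastforce
qed

section \<open>Coded points\<close>

text \<open>The inverse branch with expanding itinerary \<open>w\<close> and leading central digits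
  \<open>ds\<close>; \<open>y\<close> is what remains of the point once both strings are used
  up.\<close>

definition coded :: "nat list \<Rightarrow> nat list \<Rightarrow> int \<Rightarrow> real \<times> real \<Rightarrow> real \<times> real" where
  "coded w ds k y = (u.point w k (fst y), c.point ds 0 (snd y))"

definition cell :: "nat list \<Rightarrow> nat list \<Rightarrow> int \<Rightarrow> (real \<times> real) set" where
  "cell w ds k = u.cyl w k \<times> c.cyl ds 0"

lemma cell_eq_image: "cell w ds k = coded w ds k ` ({0<..<1} \<times> {0<..<1})"
proof -
  have "coded w ds k = map_prod (u.point w k) (c.point ds 0)"
    by (auto simp: coded_def fun_eq_iff)
  then show ?thesis
    unfolding cell_def u.cyl_def c.cyl_def by (simp only: map_prod_surj_on[OF refl refl])
qed

text \<open>An alpha strips its letter from the expanding code and squeezes the square into a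
  horizontal strip, which puts the letter's index in front of the digits. The remainder
  \<open>y\<close> is untouched.\<close>

lemma baker_alpha_coded:
  assumes "s < M" "set w \<subseteq> {..<Suc M}" "set ds \<subseteq> {..<M}" "y \<in> {0<..<1} \<times> {0<..<1}"
  shows "baker M (a k) (coded (s # w) ds k y) = coded w (s # ds) (k + 1) y"
proof -
  let ?v = "u.point w (k + 1) (fst y)" and ?e = "c.point ds 0 (snd y)"
  have v: "0 < ?v" "?v < 1" "0 < ?e" "?e < 1"
    using u.point_in[OF assms(2), of "fst y" "k + 1"] c.point_in[OF assms(3), of "snd y" 0] assms(4)
    by auto
  have x: "coded (s # w) ds k y = (real s * a k + a k * ?v, ?e)"
    using assms(1) by (simp add: coded_def)
  have "real s * a k + a k * ?v \<in> {(real (Suc s) - 1) * a k ..< real (Suc s) * a k}"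
    using v a_pos[of k] by (simp add: algebra_simps)
  moreover have "Suc s \<in> {1..M}" using assms(1) by simp
  ultimately have "baker M (a k) (real s * a k + a k * ?v, ?e) =
      ((real s * a k + a k * ?v - (real (Suc s) - 1) * a k) / a k,
        ?e / real M + (real (Suc s) - 1) / real M)"
    using v a_pos[of k] by (subst baker_alpha[of _ "Suc s"])
      (auto simp: Omega_alpha_def tau_alpha[of _ "Suc s"])
  also have "\<dots> = coded w (s # ds) (k + 1) y"
    using a_pos[of k] c_point_cong[of ds 0 "snd y" 1] by (simp add: coded_def)
  finally show ?thesis using x by simp
qed

text \<open>A beta stretches the strip of the leading digit over the full height, which deletes this
  digit.\<close>

lemma baker_beta_coded:
  assumes "s = M" "set w \<subseteq> {..<Suc M}" "set (d # ds) \<subseteq> {..<M}" "y \<in> {0<..<1} \<times> {0<..<1}"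
  shows "baker M (a k) (coded (s # w) (d # ds) k y) = coded w ds (k + 1) y"
proof -
  let ?v = "u.point w (k + 1) (fst y)" and ?e = "c.point ds 0 (snd y)"
  let ?b = "1 - real M * a k"
  have ds: "set ds \<subseteq> {..<M}" "d < M" using assms(3) by auto
  have v: "0 < ?v" "?v < 1" "0 < ?e" "?e < 1"
    using u.point_in[OF assms(2), of "fst y" "k + 1"] c.point_in[OF ds(1), of "snd y" 0] assms(4)
    by auto
  have b: "0 < ?b" using Ma_le[of k] Mq_less by simp
  have x: "coded (s # w) (d # ds) k y = (real M * a k + ?b * ?v, real d / real M + ?e / real M)"
    using assms(1) c_point_cong[of ds 0 "snd y" 1] by (simp add: coded_def)
  have "0 \<le> ?b * ?v" "?b * ?v \<le> ?b" using v b by auto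
  then have xu: "real M * a k + ?b * ?v \<in> {real M * a k .. 1}" by simp
  have "real d / real M + ?e / real M \<in> {(real (Suc d) - 1) / real M ..< real (Suc d) / real M}"
    using v M_pos by (auto simp: field_simps)
  then have "(real M * a k + ?b * ?v, real d / real M + ?e / real M) \<in> Omega_beta M (a k) (Suc d)"
  proof (cases "Suc d < M")
    \<comment> \<open>The top strip in \<open>Omega_beta\<close> is closed and written differently,
      hence a separate case.\<close>
    case False
    then have "real M = real (Suc d)" using ds(2) by simp
    then show ?thesis using xu \<open>real d / real M + ?e / real M \<in> _\<close> False
      by (simp add: Omega_beta_def)
  qed (use xu in \<open>simp add: Omega_beta_def\<close>)
  moreover have "Suc d \<in> {1..M}" using ds(2) by simp
  ultimately have "baker M (a k) (real M * a k + ?b * ?v, real d / real M + ?e / real M) =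
      ((real M * a k + ?b * ?v - real M * a k) / ?b,
        real M * (real d / real M + ?e / real M) - real (Suc d) + 1)"
    using a_pos[of k] xu by (subst baker_beta[of _ "Suc d"]) (simp_all add: tau_beta)
  also have "\<dots> = coded w ds (k + 1) y"
    using b M_pos by (simp add: coded_def field_simps)
  finally show ?thesis using x by simp
qed

text \<open>Each step rewrites only the two strings and keeps \<open>y\<close>. The digits
  \<open>es\<close> are chosen before \<open>y\<close>, so that two points of one cell can be
  compared at the same time.\<close>

lemma baker_iter_coded:
  assumes "clears w (length ds)" "set w \<subseteq> {..<Suc M}" "set ds \<subseteq> {..<M}"
    and "j \<le> length w"
  shows "\<exists>es. set es \<subseteq> {..<M} \<and> clears (drop j w) (length es) \<and>
    (\<forall>y\<in>{0<..<1} \<times> {0<..<1}. baker_iter M a k j (coded w ds k y) = coded (drop j w) es (k + int j) y)"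
  using assms
proof (induction w arbitrary: ds k j)
  case Nil
  then show ?case by auto
next
  case (Cons s w)
  show ?case
  proof (cases j)
    case 0
    then show ?thesis using Cons.prems by auto
  next
    case (Suc i)
    have w: "set w \<subseteq> {..<Suc M}" "i \<le> length w" using Cons.prems Suc by auto
    have "\<exists>ds'. set ds' \<subseteq> {..<M} \<and> clears w (length ds') \<and>
      (\<forall>y\<in>{0<..<1} \<times> {0<..<1}. baker M (a k) (coded (s # w) ds k y) = coded w ds' (k + 1) y)"
    proof (cases "s < M")
      case True
      then show ?thesis
        using clears_push[OF Cons.prems(1)] baker_alpha_coded[of s w ds _ k] w Cons.prems(3)
        by (intro exI[of _ "s # ds"]) auto
    next
      case False
      then have "s = M" using Cons.prems(2) by auto
      obtain m where m: "length ds = Suc m" "clears w m"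
        using clears_pop[OF Cons.prems(1) False] by blast
      then obtain d es where ds: "ds = d # es" by (cases ds) auto
      then show ?thesis
        using m baker_beta_coded[OF \<open>s = M\<close> w(1), of d es _ k] Cons.prems(3)
        by (intro exI[of _ es]) auto
    qed
    then obtain ds' where ds': "set ds' \<subseteq> {..<M}" "clears w (length ds')"
      "\<And>y. y \<in> {0<..<1} \<times> {0<..<1} \<Longrightarrow>
        baker M (a k) (coded (s # w) ds k y) = coded w ds' (k + 1) y" by blast
    have "k + 1 + int i = k + int (Suc i)" by simp
    then show ?thesis
      using Cons.IH[OF ds'(2) w(1) ds'(1) w(2), of "k + 1"] ds'(3)
      unfolding Suc by (simp only: drop_Suc_Cons baker_iter_Suc_left) (metis (no_types, lifting))
  qed
qed

section \<open>Contraction rates of the inverse branches\<close>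

lemma norm_coded_diff_le:
  assumes "0 \<le> r" "0 \<le> u.width w k" "u.width w k \<le> r" "c.width ds 0 \<le> r"
  shows "norm (coded w ds k y - coded w ds k y') \<le> r * norm (y - y')"
proof (rule power2_le_imp_le)
  have u: "fst (coded w ds k y) - fst (coded w ds k y') = u.width w k * (fst y - fst y')"
    unfolding coded_def fst_conv by (subst (1 2) u.point_affine) (simp add: algebra_simps)
  have c: "snd (coded w ds k y) - snd (coded w ds k y') = c.width ds 0 * (snd y - snd y')"
    unfolding coded_def snd_conv by (subst (1 2) c.point_affine) (simp add: algebra_simps)
  have "(u.width w k)\<^sup>2 \<le> r\<^sup>2" "(c.width ds 0)\<^sup>2 \<le> r\<^sup>2"
    using assms by (auto intro!: power_mono simp: c_width)
  then have "(u.width w k)\<^sup>2 * (fst y - fst y')\<^sup>2 + (c.width ds 0)\<^sup>2 * (snd y - snd y')\<^sup>2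
      \<le> r\<^sup>2 * (fst y - fst y')\<^sup>2 + r\<^sup>2 * (snd y - snd y')\<^sup>2"
    by (intro add_mono mult_right_mono) auto
  then show "(norm (coded w ds k y - coded w ds k y'))\<^sup>2 \<le> (r * norm (y - y'))\<^sup>2"
    unfolding power_mult_distrib norm_diff_sqr_prod u c by (simp add: distrib_left)
qed (use assms in simp)

lemma u_width_le_1: "set w \<subseteq> {..<Suc M} \<Longrightarrow> u.width w k \<le> 1"
proof (induction w arbitrary: k)
  case (Cons s w)
  then show ?case
    using u.wid_le_1[of s k] u.wid_pos[of s k] u.width_pos[of w "k + 1"]
    unfolding u.width.simps by (intro mult_le_one) auto
qed simp

text \<open>The first letter suffices, the others having width at most 1. For a beta use a_k >= p;
  for an alpha, M >= 2 gives a_k < 1/4, while 1 - M p > 1/2. The reciprocal of this bound becomes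
  the expansion constant.\<close>

lemma u_width_le:
  assumes "set w \<subseteq> {..<Suc M}" "w \<noteq> []"
  shows "u.width w k \<le> 1 - real M * p"
proof -
  obtain s v where w: "w = s # v" using assms(2) by (cases w) auto
  let ?r = "if s < M then a k else 1 - real M * a k"
  have "2 * a k \<le> real M * a k" using M_ge_2 a_pos[of k] by simp
  then have "a k \<le> 1 - real M * p"
    using Ma_le[of k] Ma_ge[of k] Mq_less by linarith
  then have "?r \<le> 1 - real M * p" using Ma_ge[of k] by (smt (verit))
  moreover have "0 < ?r" using u.wid_pos[of s k] assms w by auto
  moreover have "u.width v (k + 1) \<le> 1" "0 < u.width v (k + 1)"
    using u_width_le_1 u.width_pos assms w by auto
  ultimately have "?r * u.width v (k + 1) \<le> (1 - real M * p) * 1"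
    by (intro mult_mono) auto
  then show ?thesis using w by simp
qed

lemma c_width_le:
  assumes "ds \<noteq> []"
  shows "c.width ds k \<le> 1 - real M * p"
proof -
  have "real M ^ 1 \<le> real M ^ length ds"
    using assms M_ge_2 by (intro power_increasing) (auto simp: Suc_le_eq)
  then have "2 \<le> real M ^ length ds"
    using M_ge_2 unfolding power_one_right by linarith
  then have "c.width ds k \<le> 1 / 2" unfolding c_width by (intro frac_le) auto
  then show ?thesis using Ma_ge[of 0] Ma_le[of 0] Mq_less by simp
qed

section \<open>Stopping words\<close>

text \<open>A word stops at the first time \<open>n \<ge> 2\<close> at which its height is positive. Earlier heights
  are then at most \<open>0\<close>, except for that of the first letter, so the final height is maximal.\<close>

definition stopping :: "nat list \<Rightarrow> bool" where
  "stopping w \<longleftrightarrow> set w \<subseteq> {..<Suc M} \<and> 2 \<le> length w \<and> 0 < height w \<and>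
    (\<forall>j. 2 \<le> j \<and> j < length w \<longrightarrow> height (take j w) \<le> 0)"

lemma stopping_set: "stopping w \<Longrightarrow> set w \<subseteq> {..<Suc M}"
  and stopping_length: "stopping w \<Longrightarrow> 2 \<le> length w"
  and stopping_height: "stopping w \<Longrightarrow> 0 < height w"
  by (simp_all add: stopping_def)

text \<open>Prefixes of length 0 and 1 have height at most 1, longer proper ones at most 0, and the
  final height is at least 1. So that many initial digits suffice for all pops.\<close>

lemma stopping_clears:
  assumes "stopping w"
  shows "clears w (nat (height w))"
proof -
  have "height (take j w) \<le> height w" if "j \<le> length w" for j
  proof (cases "2 \<le> j \<and> j < length w")
    case True
    then show ?thesis using assms unfolding stopping_def by force
  next
    case False
    then have "j = 0 \<or> j = 1 \<or> j = length w" using that by linarith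
    then consider "j = 0" | "j = 1" | "j = length w" by blast
    then show ?thesis
    proof cases
      case 2
      have "height (take 1 w) \<le> 1" by (cases w) auto
      then show ?thesis using 2 stopping_height[OF assms] by simp
    qed (use stopping_height[OF assms] in auto)
  qed
  then show ?thesis using stopping_height[OF assms] by (simp add: clears_def)
qed

text \<open>Two such words are comparable as prefixes. A proper prefix of length at least 2 of a
  stopping word has height at most 0, so it cannot stop itself.\<close>

lemma stopping_unique:
  assumes "stopping w" "stopping w'" "x \<in> u.cyl w k" "x \<in> u.cyl w' k"
  shows "w = w'"
proof -
  have *: "w = w'" if "stopping w" "stopping w'" "x \<in> u.cyl w k" "x \<in> u.cyl w' k"
    "length w \<le> length w'" for w w'
  proof -
    have w: "w = take (length w) w'"
      using u.cyl_prefix[OF _ _ that(3-5)] that(1,2) stopping_set by blast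
    have "\<not> length w < length w'"
    proof
      assume "length w < length w'"
      then have "height w \<le> 0"
        using w that(2) stopping_length[OF that(1)] unfolding stopping_def by metis
      then show False using stopping_height[OF that(1)] by simp
    qed
    then show ?thesis using w by simp
  qed
  show ?thesis
    using *[of w w'] *[of w' w] assms by (cases "length w \<le> length w'") auto
qed

lemma stopping_exists:
  assumes "set w \<subseteq> {..<Suc M}" "2 \<le> length w" "0 < height w"
  shows "\<exists>j\<le>length w. stopping (take j w)"
proof -
  define j where "j = (LEAST j. 2 \<le> j \<and> 0 < height (take j w))"
  have j: "2 \<le> j" "0 < height (take j w)" "j \<le> length w"
    using LeastI[of "\<lambda>j. 2 \<le> j \<and> 0 < height (take j w)" "length w"]
      Least_le[of "\<lambda>j. 2 \<le> j \<and> 0 < height (take j w)" "length w"] assms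
    by (simp_all add: j_def)
  have "height (take i w) \<le> 0" if "2 \<le> i" "i < j" for i
    using not_less_Least[of i "\<lambda>j. 2 \<le> j \<and> 0 < height (take j w)"] that by (auto simp: j_def)
  moreover have "set (take j w) \<subseteq> {..<Suc M}"
    using assms(1) by (rule order_trans[OF set_take_subset])
  ultimately have "stopping (take j w)"
    using j by (simp add: stopping_def min_def)
  then show ?thesis using j by blast
qed

text \<open>At most one word contributes, by \<open>stopping_unique\<close>, so the infimum is its
  length. Over the empty set it is infinity, the value at points in no stopping cylinder.\<close>

definition rtime :: "int \<Rightarrow> real \<times> real \<Rightarrow> ereal" where
  "rtime k x = (INF w\<in>{w. stopping w \<and> fst x \<in> u.cyl w k}. ereal (real (length w)))"

lemma rtime_eq:
  assumes "stopping w" "fst x \<in> u.cyl w k"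
  shows "rtime k x = ereal (real (length w))"
proof -
  have "{w. stopping w \<and> fst x \<in> u.cyl w k} = {w}"
    using assms stopping_unique by blast
  then show ?thesis by (simp add: rtime_def)
qed

lemma rtime_eq_iff:
  "rtime k x = ereal (real n) \<longleftrightarrow> (\<exists>w. stopping w \<and> length w = n \<and> fst x \<in> u.cyl w k)"
proof
  assume n: "rtime k x = ereal (real n)"
  have "{w. stopping w \<and> fst x \<in> u.cyl w k} \<noteq> {}"
  proof
    assume e: "{w. stopping w \<and> fst x \<in> u.cyl w k} = {}"
    have "rtime k x = \<infinity>" unfolding rtime_def e by (simp add: top_ereal_def)
    then show False using n by simp
  qed
  then show "\<exists>w. stopping w \<and> length w = n \<and> fst x \<in> u.cyl w k"
    using n rtime_eq by fastforce
qed (use rtime_eq in blast)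

lemma rtime_ge_2: "2 \<le> rtime k x"
  unfolding rtime_def by (rule INF_greatest) (use stopping_length in force)

text \<open>Taking exactly \<open>height w\<close> digits makes both strings run out at the same
  moment, which is what makes the return map onto the open square.\<close>

definition cells :: "int \<Rightarrow> (real \<times> real) set set" where
  "cells k = {cell w ds k |w ds. stopping w \<and> set ds \<subseteq> {..<M} \<and> length ds = nat (height w)}"

lemma cellsE:
  assumes "W \<in> cells k"
  obtains w ds where "W = cell w ds k" "stopping w" "set ds \<subseteq> {..<M}" "length ds = nat (height w)"
  using assms unfolding cells_def by blast

lemma countable_cells: "countable (cells k)"
proof -
  have "cells k \<subseteq> (\<lambda>(w, ds). cell w ds k) ` UNIV" unfolding cells_def by auto
  then show ?thesis by (rule countable_subset) simp
qed

lemma open_cells: "W \<in> cells k \<Longrightarrow> open W"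
  by (elim cellsE) (simp add: cell_def open_Times u.open_cyl c.open_cyl stopping_set)

lemma cells_nonempty: "W \<in> cells k \<Longrightarrow> W \<noteq> {}"
  by (elim cellsE) (simp add: cell_def u.cyl_nonempty c.cyl_nonempty)

lemma cells_subset: "W \<in> cells k \<Longrightarrow> W \<subseteq> {0<..<1} \<times> {0<..<1}"
  by (elim cellsE) (auto simp: cell_def dest: subsetD[OF u.cyl_subset[OF stopping_set]]
      subsetD[OF c.cyl_subset])

lemma cells_disjoint:
  assumes "W \<in> cells k" "W' \<in> cells k" "x \<in> W" "x \<in> W'"
  shows "W = W'"
proof -
  obtain w ds where w: "W = cell w ds k" "stopping w" "set ds \<subseteq> {..<M}" "length ds = nat (height w)"
    using assms(1) by (rule cellsE)
  obtain w' ds' where w': "W' = cell w' ds' k" "stopping w'" "set ds' \<subseteq> {..<M}"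
    "length ds' = nat (height w')"
    using assms(2) by (rule cellsE)
  have "w = w'"
    using stopping_unique[OF w(2) w'(2), of "fst x" k] assms(3,4) w(1) w'(1) by (auto simp: cell_def)
  moreover have "ds = ds'"
    using c.cyl_length_unique[OF w(3) w'(3), of "snd x" 0] \<open>w = w'\<close> w w' assms(3,4)
    by (auto simp: cell_def)
  ultimately show ?thesis using w w' by simp
qed

lemma partition_cells: "partition_on (\<Union>(cells k)) (cells k)"
proof (rule partition_onI)
  show "disjnt W W'" if "W \<in> cells k" "W' \<in> cells k" "W \<noteq> W'" for W W'
    using cells_disjoint that unfolding disjnt_iff by metis
qed (use cells_nonempty in auto)

lemma measure_cells_pos:
  assumes "W \<in> cells k"
  shows "0 < measure square_measure W"
proof -
  obtain w ds where w: "W = cell w ds k" "stopping w" "set ds \<subseteq> {..<M}"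
    using assms by (rule cellsE)
  have "measure square_measure W = measure lborel (u.cyl w k) * measure lborel (c.cyl ds 0)"
    unfolding w(1) cell_def
    using u.open_cyl[OF stopping_set[OF w(2)], of k] c.open_cyl[OF w(3), of 0]
      u.cyl_subset[OF stopping_set[OF w(2)], of k] c.cyl_subset[OF w(3), of 0]
    by (intro measure_square_Times) auto
  also have "\<dots> > 0"
    using u.width_pos[OF stopping_set[OF w(2)], of k] c.width_pos[OF w(3), of 0]
    by (simp add: u.measure_cyl[OF stopping_set[OF w(2)]] c.measure_cyl[OF w(3)])
  finally show ?thesis .
qed

section \<open>The dynamics on a single cell\<close>

lemma rtime_cell:
  assumes "stopping w" "x \<in> cell w ds k"
  shows "rtime k x = ereal (real (length w))"
  using rtime_eq assms by (auto simp: cell_def)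

lemma const_value_cell:
  assumes "stopping w"
  shows "const_value (rtime k) (cell w ds k) = length w"
proof -
  obtain x where "x \<in> cell w ds k"
    using u.cyl_nonempty c.cyl_nonempty unfolding cell_def by blast
  moreover have "\<forall>x\<in>cell w ds k. rtime k x = ereal (real (length w))"
    using rtime_cell[OF assms] by blast
  ultimately show ?thesis
    unfolding const_value_def by (intro the_equality) (blast, metis ereal.inject of_nat_eq_iff)
qed

lemma baker_iter_cell:
  assumes "stopping w" "set ds \<subseteq> {..<M}" "length ds = nat (height w)"
    and "y \<in> {0<..<1} \<times> {0<..<1}"
  shows "baker_iter M a k (length w) (coded w ds k y) = y"
proof -
  have "clears w (length ds)" using stopping_clears[OF assms(1)] assms(3) by simp
  from baker_iter_coded[OF this stopping_set[OF assms(1)] assms(2) order_refl, of k]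
  obtain es where es: "clears [] (length es)"
    "baker_iter M a k (length w) (coded w ds k y) = coded [] es (k + int (length w)) y"
    using assms(4) by auto
  \<comment> \<open>The empty word has height 0, so clearing the stack with it means that no digit
    is left.\<close>
  have "es = []" using es(1) by (simp add: clears_def)
  then show ?thesis using es(2) by (simp add: coded_def)
qed

text \<open>At time \<open>j\<close> the points are images of \<open>y\<close> and \<open>y'\<close>
  under a common inverse branch, whose two contraction factors are at most 1; \<open>y\<close> and
  \<open>y'\<close> are the final positions.\<close>

lemma baker_iter_dist_le:
  assumes "stopping w" "set ds \<subseteq> {..<M}" "length ds = nat (height w)" "j \<le> length w"
    and "y \<in> {0<..<1} \<times> {0<..<1}" "y' \<in> {0<..<1} \<times> {0<..<1}"
  shows "norm (baker_iter M a k j (coded w ds k y) - baker_iter M a k j (coded w ds k y'))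
    \<le> norm (y - y')"
proof -
  have "clears w (length ds)" using stopping_clears[OF assms(1)] assms(3) by simp
  from baker_iter_coded[OF this stopping_set[OF assms(1)] assms(2,4), of k]
  obtain es where es: "\<forall>y\<in>{0<..<1} \<times> {0<..<1}.
      baker_iter M a k j (coded w ds k y) = coded (drop j w) es (k + int j) y"
    by blast
  have w: "set (drop j w) \<subseteq> {..<Suc M}"
    using stopping_set[OF assms(1)] by (rule order_trans[OF set_drop_subset])
  have "1 \<le> real M ^ length es" using M_ge_2 by (intro one_le_power) simp
  then have "c.width es 0 \<le> 1 / 1" unfolding c_width by (intro frac_le) auto
  then have "norm (coded (drop j w) es (k + int j) y - coded (drop j w) es (k + int j) y')
      \<le> 1 * norm (y - y')"
    using u_width_le_1[OF w] u.width_pos[OF w, of "k + int j"]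
    by (intro norm_coded_diff_le) auto
  then show ?thesis unfolding bspec[OF es assms(5)] bspec[OF es assms(6)] by simp
qed

lemma affine_cell:
  assumes "stopping w" "set ds \<subseteq> {..<M}" "length ds = nat (height w)"
  shows "affine_map_on (cell w ds k) (baker_iter M a k (length w))"
proof -
  \<comment> \<open>\<open>coded w ds k\<close> is diagonal and affine; this is the linear part of
    its inverse, and \<open>?b\<close> the translation.\<close>
  let ?L = "\<lambda>x :: real \<times> real. (fst x / u.width w k, snd x / c.width ds 0)"
  let ?b = "(- u.point w k 0 / u.width w k, - c.point ds 0 0 / c.width ds 0)"
  have "linear ?L"
    by (intro linearI) (auto simp: add_divide_distrib)
  moreover have "baker_iter M a k (length w) x = ?L x + ?b" if x: "x \<in> cell w ds k" for x
  proof -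
    obtain y where y: "y \<in> {0<..<1} \<times> {0<..<1}" "x = coded w ds k y"
      using x unfolding cell_eq_image by blast
    have "fst x = u.point w k 0 + u.width w k * fst y"
      unfolding y(2) coded_def fst_conv by (rule u.point_affine)
    moreover have "snd x = c.point ds 0 0 + c.width ds 0 * snd y"
      unfolding y(2) coded_def snd_conv by (rule c.point_affine)
    ultimately have "?L x + ?b = y"
      using u.width_pos[OF stopping_set[OF assms(1)], of k] c.width_pos[OF assms(2), of 0]
      by (cases y) (simp add: field_simps)
    then show ?thesis using baker_iter_cell[OF assms y(1), of k] y(2) by simp
  qed
  ultimately show ?thesis unfolding affine_map_on_def by blast
qed

text \<open>Positive height provides at least one letter and one digit, so the inverse branch
  contracts both coordinates by 1 - M p.\<close>

lemma expansion_cell: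
  assumes "stopping w" "set ds \<subseteq> {..<M}" "length ds = nat (height w)"
    and "y \<in> {0<..<1} \<times> {0<..<1}" "y' \<in> {0<..<1} \<times> {0<..<1}"
  shows "1 / (1 - real M * p) * norm (coded w ds k y - coded w ds k y') \<le> norm (y - y')"
proof -
  have pos: "0 < 1 - real M * p" using Ma_ge[of 0] Ma_le[of 0] Mq_less by simp
  have "w \<noteq> []" "ds \<noteq> []"
    using stopping_length[OF assms(1)] stopping_height[OF assms(1)] assms(3) by auto
  then have "norm (coded w ds k y - coded w ds k y') \<le> (1 - real M * p) * norm (y - y')"
    using pos u.width_pos[OF stopping_set[OF assms(1)], of k]
    by (intro norm_coded_diff_le u_width_le c_width_le stopping_set assms) auto
  then show ?thesis using pos by (simp add: field_simps)
qed

section \<open>The tail of the return time\<close>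

text \<open>Only the height at time \<open>n\<close> itself is tested: for n >= 2 a positive height
  there means that some prefix has stopped.\<close>

definition slow :: "nat \<Rightarrow> nat list set" where
  "slow n = {w \<in> u.wordset n. height w \<le> 0}"

definition tail_cover :: "nat \<Rightarrow> int \<Rightarrow> real set" where
  "tail_cover n k = u.bad n k \<union> (\<Union>w\<in>slow n. u.cyl w k)"

text \<open>Any \<open>\<theta>\<close> strictly between \<open>1\<close> and \<open>(1 - Mq)/(Mq)\<close> makes the exponential moment
  \<open>Mq \<theta> + (1 - Mq)/\<theta>\<close> of one step smaller than \<open>1\<close>; this choice gives the value \<open>\<rho>\<close>.\<close>

definition \<theta> :: real where "\<theta> = 1 / (2 * (real M * q))"

definition \<rho> :: real where "\<rho> = 1 / 2 + 2 * (real M * q) * (1 - real M * q)"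

lemma Mq_pos: "0 < real M * q"
  using a_pos[of 0] a_le[of 0] M_pos by simp

lemma \<theta>_gt_1: "1 < \<theta>"
  using Mq_pos Mq_less by (simp add: \<theta>_def field_simps)

lemma \<rho>_bounds: "0 < \<rho>" "\<rho> < 1"
proof -
  \<comment> \<open>Half of this square is 1 - \<rho>.\<close>
  have "0 < (1 - 2 * (real M * q))\<^sup>2" using Mq_less by simp
  then show "\<rho> < 1" by (simp add: \<rho>_def power2_eq_square algebra_simps)
  have "0 < 2 * (real M * q) * (1 - real M * q)"
    by (rule mult_pos_pos) (use Mq_pos Mq_less in linarith)+
  then show "0 < \<rho>" unfolding \<rho>_def by linarith
qed

text \<open>Since \<theta> exceeds its inverse, the moment increases with a_k. At a_k = q its two
  terms are 1/2 and 2 M q (1 - M q).\<close>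

lemma step_moment_le: "real M * a k * \<theta> + (1 - real M * a k) * inverse \<theta> \<le> \<rho>"
proof -
  have "inverse \<theta> \<le> 1" using \<theta>_gt_1 by (simp add: inverse_le_1_iff)
  then have "inverse \<theta> \<le> \<theta>" using \<theta>_gt_1 by linarith
  then have "real M * a k * (\<theta> - inverse \<theta>) \<le> real M * q * (\<theta> - inverse \<theta>)"
    using Ma_le[of k] by (intro mult_right_mono) auto
  then have "real M * a k * \<theta> + (1 - real M * a k) * inverse \<theta>
      \<le> real M * q * \<theta> + (1 - real M * q) * inverse \<theta>"
    by (simp add: algebra_simps)
  also have "\<dots> = \<rho>"
  proof -
    define x where "x = real M * q"
    then show ?thesis
      using Mq_pos unfolding \<theta>_def \<rho>_def x_def[symmetric] by (simp add: field_simps)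
  qed
  finally show ?thesis .
qed

text \<open>With widths as probabilities this is the expectation of \<theta> to the power minus
  height. Splitting off the first letter yields the factor of one step; \<open>k\<close> varies in
  the induction because the letter probabilities change with time.\<close>

lemma moment_le: "(\<Sum>w\<in>u.wordset n. u.width w k * \<theta> powi (- height w)) \<le> \<rho> ^ n"
proof (induction n arbitrary: k)
  case 0
  then show ?case by (simp add: u.wordset_0)
next
  case (Suc n)
  have \<theta>: "\<theta> \<noteq> 0" using \<theta>_gt_1 by simp
  define S where "S = (\<Sum>w\<in>u.wordset n. u.width w (k + 1) * \<theta> powi (- height w))"
  have alpha: "(\<Sum>w\<in>u.wordset n. u.width (s # w) k * \<theta> powi (- height (s # w))) = a k * \<theta> * S"
    if "s < M" for s
    unfolding S_def sum_distrib_left using that \<theta>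
    by (intro sum.cong) (simp_all add: power_int_diff power_int_minus field_simps)
  have beta: "(\<Sum>w\<in>u.wordset n. u.width (M # w) k * \<theta> powi (- height (M # w)))
      = (1 - real M * a k) * inverse \<theta> * S"
    unfolding S_def sum_distrib_left using \<theta>
    by (intro sum.cong) (simp_all add: power_int_diff power_int_minus field_simps)
  have "(\<Sum>w\<in>u.wordset (Suc n). u.width w k * \<theta> powi (- height w))
      = (\<Sum>s<M. a k * \<theta> * S) + (1 - real M * a k) * inverse \<theta> * S"
    unfolding u.sum_wordset_Suc sum.lessThan_Suc beta
    by (intro arg_cong2[where f = "(+)"] sum.cong refl alpha) simp
  also have "\<dots> = (real M * a k * \<theta> + (1 - real M * a k) * inverse \<theta>) * S"
    by (simp add: algebra_simps)
  also have "\<dots> \<le> \<rho> * \<rho> ^ n"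
  proof (rule mult_mono)
    show "S \<le> \<rho> ^ n" unfolding S_def by (rule Suc)
    have "0 \<le> u.width w (k + 1)" if "w \<in> u.wordset n" for w
      using that u.width_pos[of w "k + 1"] by (simp add: u.wordset_def)
    then show "0 \<le> S"
      using \<theta>_gt_1 unfolding S_def by (intro sum_nonneg mult_nonneg_nonneg) auto
  qed (use step_moment_le \<rho>_bounds in auto)
  finally show ?case by simp
qed

text \<open>Markov's inequality: the weight \<theta> to the power minus height is at least 1 on slow
  words.\<close>

lemma slow_width_le: "(\<Sum>w\<in>slow n. u.width w k) \<le> \<rho> ^ n"
proof -
  have pos: "0 < u.width w k" if "w \<in> u.wordset n" for w
    using that by (auto simp: u.wordset_def intro!: u.width_pos)
  have "(\<Sum>w\<in>slow n. u.width w k) \<le> (\<Sum>w\<in>slow n. u.width w k * \<theta> powi (- height w))"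
  proof (rule sum_mono)
    fix w assume "w \<in> slow n"
    then have "w \<in> u.wordset n" "0 \<le> - height w" by (auto simp: slow_def)
    then have "1 \<le> \<theta> powi (- height w)"
      using \<theta>_gt_1 by (intro one_le_power_int) auto
    then show "u.width w k \<le> u.width w k * \<theta> powi (- height w)"
      using pos[OF \<open>w \<in> u.wordset n\<close>] by simp
  qed
  also have "\<dots> \<le> (\<Sum>w\<in>u.wordset n. u.width w k * \<theta> powi (- height w))"
    using \<theta>_gt_1 by (intro sum_mono2 u.finite_wordset mult_nonneg_nonneg less_imp_le[OF pos])
      (auto simp: slow_def)
  also have "\<dots> \<le> \<rho> ^ n" by (rule moment_le)
  finally show ?thesis .
qed

lemma finite_slow: "finite (slow n)"
  unfolding slow_def using u.finite_wordset by simp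

lemma slow_set: "w \<in> slow n \<Longrightarrow> set w \<subseteq> {..<Suc M}"
  by (simp add: slow_def u.wordset_def)

lemma tail_cover_borel: "tail_cover n k \<in> sets borel"
  unfolding tail_cover_def
  by (intro sets.Un sets.finite_UN finite_slow borel_closed finite_imp_closed u.finite_bad
      borel_open u.open_cyl slow_set)

lemma tail_cover_subset: "tail_cover n k \<subseteq> {0..1}"
proof -
  have "u.cyl w k \<subseteq> {0..1}" if "w \<in> slow n" for w
    using u.cyl_subset[OF slow_set[OF that], of k] by force
  then show ?thesis unfolding tail_cover_def u.bad_def by blast
qed

lemma measure_tail_cover: "measure lborel (tail_cover n k) \<le> \<rho> ^ n"
proof -
  have cyl: "u.cyl w k \<in> sets lborel" if "w \<in> slow n" for w
    using u.open_cyl[OF slow_set[OF that], of k] by simp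
  have "measure lborel (tail_cover n k)
      \<le> measure lborel (u.bad n k) + measure lborel (\<Union>w\<in>slow n. u.cyl w k)"
    unfolding tail_cover_def
  proof (rule measure_Un_le)
    show "u.bad n k \<in> sets lborel"
      using finite_imp_closed[OF u.finite_bad, of n k] by simp
    show "(\<Union>w\<in>slow n. u.cyl w k) \<in> sets lborel"
      by (rule sets.finite_UN[OF finite_slow cyl])
  qed
  also have "measure lborel (u.bad n k) = 0"
    unfolding measure_def emeasure_lborel_countable[OF countable_finite[OF u.finite_bad]] by simp
  also have "measure lborel (\<Union>w\<in>slow n. u.cyl w k) \<le> (\<Sum>w\<in>slow n. measure lborel (u.cyl w k))"
    by (rule measure_UNION_le[OF finite_slow cyl])
  also have "\<dots> = (\<Sum>w\<in>slow n. u.width w k)"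
    using slow_set by (intro sum.cong u.measure_cyl) auto
  also have "\<dots> \<le> \<rho> ^ n" by (rule slow_width_le)
  finally show ?thesis by simp
qed

lemma stopping_before:
  assumes "2 \<le> n" "x \<in> {0..1}" "x \<notin> tail_cover n k"
  shows "\<exists>w. stopping w \<and> length w \<le> n \<and> x \<in> u.cyl w k"
proof -
  obtain w where w: "w \<in> u.wordset n" "x \<in> u.cyl w k" "0 < height w"
    using assms(2,3) by (auto simp: tail_cover_def u.bad_def slow_def not_le)
  then have s: "set w \<subseteq> {..<Suc M}" "length w = n" by (auto simp: u.wordset_def)
  obtain j where "j \<le> n" "stopping (take j w)"
    using stopping_exists[OF s(1)] s(2) assms(1) w(3) by auto
  then show ?thesis
    using u.cyl_take[OF s(1), of k j] w(2) by (intro exI[of _ "take j w"]) auto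
qed

lemma measure_tail_le:
  assumes "2 \<le> n"
  shows "measure square_measure {x \<in> unit_square. ereal (real (Suc n)) \<le> rtime k x} \<le> \<rho> ^ n"
proof -
  have "{x \<in> unit_square. ereal (real (Suc n)) \<le> rtime k x} \<subseteq> tail_cover n k \<times> {0..1}"
  proof
    fix x assume "x \<in> {x \<in> unit_square. ereal (real (Suc n)) \<le> rtime k x}"
    then have x: "fst x \<in> {0..1}" "snd x \<in> {0..1}" "ereal (real (Suc n)) \<le> rtime k x"
      by (auto simp: unit_square_def)
    have "fst x \<in> tail_cover n k"
    proof (rule ccontr)
      assume "fst x \<notin> tail_cover n k"
      then obtain w where "stopping w" "length w \<le> n" "fst x \<in> u.cyl w k"
        using stopping_before[OF assms x(1)] by blast
      then show False using x(3) rtime_eq[of w x k] by simp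
    qed
    then show "x \<in> tail_cover n k \<times> {0..1}" using x(2) by (simp add: mem_Times_iff)
  qed
  then have "measure square_measure {x \<in> unit_square. ereal (real (Suc n)) \<le> rtime k x}
      \<le> measure square_measure (tail_cover n k \<times> {0..1})"
    using measure_square_Times(1)[OF tail_cover_borel _ tail_cover_subset, of "{0..1}"]
    by (intro finite_measure.finite_measure_mono[OF finite_measure_square]) auto
  also have "\<dots> \<le> \<rho> ^ n"
    using measure_square_Times(2)[OF tail_cover_borel _ tail_cover_subset, of "{0..1}" n k]
      measure_tail_cover[of n k] by simp
  finally show ?thesis .
qed

text \<open>The factor 1/\<rho>^2 absorbs the shift from n to n - 1 in
  \<open>measure_tail_le\<close> when n >= 3, and makes the bound at least 1, hence trivial, when n
  <= 2.\<close>

lemma measure_tail_exp: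
  assumes "1 \<le> n"
  shows "measure square_measure {x \<in> unit_square. ereal (real n) \<le> rtime k x}
    \<le> 1 / \<rho>\<^sup>2 * exp (- (- ln \<rho>) * real n)"
proof -
  have e: "exp (- (- ln \<rho>) * real n) = \<rho> ^ n"
    using \<rho>_bounds by (simp add: exp_of_nat2_mult)
  show ?thesis
  proof (cases "3 \<le> n")
    case True
    then obtain m where m: "n = Suc m" "2 \<le> m" by (cases n) auto
    have "measure square_measure {x \<in> unit_square. ereal (real n) \<le> rtime k x} \<le> \<rho> ^ m"
      using measure_tail_le[OF m(2)] m(1) by simp
    also have "\<dots> \<le> 1 / \<rho>\<^sup>2 * \<rho> ^ n"
      using m \<rho>_bounds by (simp add: power2_eq_square field_simps)
    finally show ?thesis using e by simp
  next
    case False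
    then have "\<rho>\<^sup>2 \<le> \<rho> ^ n" using \<rho>_bounds by (intro power_decreasing) auto
    then have "1 \<le> 1 / \<rho>\<^sup>2 * \<rho> ^ n" using \<rho>_bounds by (simp add: field_simps)
    then show ?thesis using e measure_square_le_1 order_trans by metis
  qed
qed

text \<open>For every n >= 2 an uncovered point has its expanding coordinate in
  \<open>tail_cover n k\<close> or its central one in a countable set, so the area is at most
  \<rho>^n; let n grow. The countable set gathers all digit lengths, as the length required depends
  on the word.\<close>

lemma measure_uncovered: "measure square_measure (interior unit_square - \<Union>(cells k)) = 0"
proof -
  let ?D = "interior unit_square - \<Union>(cells k)" and ?B = "\<Union>n. c.bad n 0"
  have cB: "countable ?B"
    using c.finite_bad by (intro countable_UN) (auto intro: countable_finite)
  have "c.bad n 0 \<in> sets borel" for n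
    by (rule borel_closed[OF finite_imp_closed[OF c.finite_bad]])
  then have B: "?B \<in> sets borel" by (intro sets.countable_UN) auto
  have B01: "?B \<subseteq> {0..1}" unfolding c.bad_def by blast
  have B0: "measure lborel ?B = 0"
    unfolding measure_def emeasure_lborel_countable[OF cB] by simp
  have le: "measure square_measure ?D \<le> \<rho> ^ n" if n: "2 \<le> n" for n
  proof -
    have "?D \<subseteq> tail_cover n k \<times> {0..1} \<union> {0..1} \<times> ?B"
    proof
      fix x assume x: "x \<in> ?D"
      then have "x \<in> {0<..<1} \<times> {0<..<1}" using interior_unit_square by blast
      then have x01: "fst x \<in> {0..1}" "snd x \<in> {0..1}" by auto
      show "x \<in> tail_cover n k \<times> {0..1} \<union> {0..1} \<times> ?B"
      proof (rule ccontr)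
        assume "x \<notin> tail_cover n k \<times> {0..1} \<union> {0..1} \<times> ?B"
        then have nx: "fst x \<notin> tail_cover n k" "snd x \<notin> ?B"
          using x01 by (auto simp: mem_Times_iff)
        obtain w where w: "stopping w" "fst x \<in> u.cyl w k"
          using stopping_before[OF n x01(1) nx(1)] by blast
        have "snd x \<notin> c.bad (nat (height w)) 0" using nx(2) by blast
        then obtain ds where "ds \<in> c.wordset (nat (height w))" "snd x \<in> c.cyl ds 0"
          using x01(2) by (auto simp: c.bad_def)
        then have "cell w ds k \<in> cells k" "x \<in> cell w ds k"
          using w unfolding cells_def cell_def c.wordset_def mem_Times_iff fst_conv snd_conv
          by auto
        then show False using x by blast
      qed
    qed
    moreover have T: "tail_cover n k \<times> {0..1} \<in> sets square_measure"
      "{0..1} \<times> ?B \<in> sets square_measure"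
      by (intro measure_square_Times(1) tail_cover_borel tail_cover_subset B B01; simp)+
    ultimately have "measure square_measure ?D
        \<le> measure square_measure (tail_cover n k \<times> {0..1} \<union> {0..1} \<times> ?B)"
      by (intro finite_measure.finite_measure_mono[OF finite_measure_square]) auto
    also have "\<dots> \<le> measure square_measure (tail_cover n k \<times> {0..1})
        + measure square_measure ({0..1} \<times> ?B)"
      using T by (intro measure_Un_le)
    also have "\<dots> \<le> \<rho> ^ n"
      using measure_square_Times(2)[OF tail_cover_borel _ tail_cover_subset, of "{0..1}" n k]
        measure_square_Times(2)[OF _ B _ B01, of "{0..1}"] B0 measure_tail_cover[of n k] by simp
    finally show ?thesis .
  qed
  have "(\<lambda>n. \<rho> ^ n) \<longlonglongrightarrow> 0" using \<rho>_bounds by (intro LIMSEQ_power_zero) simp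
  then have "measure square_measure ?D \<le> 0"
    by (rule LIMSEQ_le_const) (use le in blast)
  then show ?thesis by (simp add: measure_le_0_iff)
qed

text \<open>A lower bound by monotonicity needs the level set measurable, so it is identified
  exactly: an open union of cylinders times the unit interval.\<close>

lemma measure_rtime_ge:
  assumes "stopping w"
  shows "u.width w k \<le> measure square_measure {x \<in> unit_square. rtime k x = ereal (real (length w))}"
proof -
  let ?n = "length w"
  let ?U = "\<Union>v\<in>{v. stopping v \<and> length v = ?n}. u.cyl v k"
  have "u.cyl v k \<subseteq> {0..1}" if "stopping v" for v
    using u.cyl_subset[OF stopping_set[OF that], of k] by force
  then have U: "open ?U" "?U \<subseteq> {0..1}"
    using u.open_cyl[OF stopping_set] by blast+
  have eq: "{x \<in> unit_square. rtime k x = ereal (real ?n)} = ?U \<times> {0..1}"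
  proof (rule set_eqI)
    fix x :: "real \<times> real"
    have "rtime k x = ereal (real ?n) \<longleftrightarrow> fst x \<in> ?U" unfolding rtime_eq_iff by blast
    then show "x \<in> {x \<in> unit_square. rtime k x = ereal (real ?n)} \<longleftrightarrow> x \<in> ?U \<times> {0..1}"
      using U(2) unfolding unit_square_def mem_Times_iff mem_Collect_eq by blast
  qed
  have "u.cyl w k \<times> {0..1} \<subseteq> ?U \<times> {0..1}" using assms by auto
  then have "measure square_measure (u.cyl w k \<times> {0..1}) \<le> measure square_measure (?U \<times> {0..1})"
    using measure_square_Times(1)[of ?U "{0..1}"] U
    by (intro finite_measure.finite_measure_mono[OF finite_measure_square]) auto
  moreover have "u.cyl w k \<subseteq> {0..1}" using U(2) assms by blast
  then have "measure square_measure (u.cyl w k \<times> {0..1}) = u.width w k"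
    using u.open_cyl[OF stopping_set[OF assms], of k]
    by (subst measure_square_Times(2)) (auto simp: u.measure_cyl[OF stopping_set[OF assms]])
  ultimately show ?thesis using eq by simp
qed

lemma measure_rtime_2: "p / 4 \<le> measure square_measure {x \<in> unit_square. rtime k x = 2}"
proof -
  have "stopping [M, M]" by (simp add: stopping_def)
  from measure_rtime_ge[OF this, of k]
  have "(1 - real M * a k) * (1 - real M * a (k + 1))
      \<le> measure square_measure {x \<in> unit_square. rtime k x = 2}" by simp
  moreover have "1 / 2 * (1 / 2) \<le> (1 - real M * a k) * (1 - real M * a (k + 1))"
    using Ma_le[of k] Ma_le[of "k + 1"] Mq_less by (intro mult_mono) auto
  \<comment> \<open>The bound 1/4 just found is weakened to p/4, the constant that also serves for
    the value 3.\<close>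
  moreover have "p \<le> real M * p" using M_ge_2 p_pos by simp
  then have "p \<le> 1" using Ma_ge[of k] Ma_le[of k] Mq_less by simp
  ultimately show ?thesis by simp
qed

lemma measure_rtime_3: "p / 4 \<le> measure square_measure {x \<in> unit_square. rtime k x = 3}"
proof -
  have "height (take j [0, M, M]) \<le> 0" if "2 \<le> j" "j < 3" for j
  proof -
    have "j = 2" using that by simp
    then show ?thesis using M_ge_2 by (simp add: numeral_2_eq_2)
  qed
  then have "stopping [0, M, M]" using M_ge_2 by (auto simp: stopping_def)
  from measure_rtime_ge[OF this, of k]
  have "a k * ((1 - real M * a (k + 1)) * (1 - real M * a (k + 2)))
      \<le> measure square_measure {x \<in> unit_square. rtime k x = 3}"
    using M_ge_2 by (simp add: add.assoc)
  moreover have "p * (1 / 2 * (1 / 2)) \<le> a k * ((1 - real M * a (k + 1)) * (1 - real M * a (k + 2)))"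
    using Ma_le[of "k + 1"] Ma_le[of "k + 2"] Mq_less a_ge[of k] p_pos by (intro mult_mono) auto
  ultimately show ?thesis by simp
qed

section \<open>The return maps\<close>

text \<open>All claims are moved to the parameters \<open>y\<close> in the open square, where
  \<open>F\<close> inverts \<open>coded w ds k\<close>.\<close>

lemma cells_return:
  assumes "W \<in> cells k"
  defines "F \<equiv> baker_comp M a k (k + int (const_value (rtime k) W) - 1)"
  shows "affine_map_on W F" "F ` W = interior unit_square"
    and "\<And>x x'. x \<in> W \<Longrightarrow> x' \<in> W \<Longrightarrow> 1 / (1 - real M * p) * norm (x - x') \<le> norm (F x - F x')"
    and "\<And>x x' j. x \<in> W \<Longrightarrow> x' \<in> W \<Longrightarrow> j \<le> const_value (rtime k) W \<Longrightarrow>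
      norm (baker_comp M a k (k + int j - 1) x - baker_comp M a k (k + int j - 1) x')
        \<le> norm (F x - F x')"
proof -
  obtain w ds where W: "W = cell w ds k"
    and w: "stopping w" "set ds \<subseteq> {..<M}" "length ds = nat (height w)"
    using assms(1) by (rule cellsE)
  have F: "F = baker_iter M a k (length w)"
    by (simp add: F_def W const_value_cell[OF w(1)] baker_comp_def)
  have Fy: "F (coded w ds k y) = y" if "y \<in> {0<..<1} \<times> {0<..<1}" for y
    unfolding F using w that by (rule baker_iter_cell)
  have coded: "\<exists>y\<in>{0<..<1} \<times> {0<..<1}. x = coded w ds k y" if "x \<in> W" for x
    using that unfolding W cell_eq_image by blast
  show "affine_map_on W F" unfolding W F using w by (rule affine_cell)
  show "F ` W = interior unit_square"
    unfolding W cell_eq_image interior_unit_square image_image using Fy by simp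
  fix x x' assume "x \<in> W" "x' \<in> W"
  then obtain y y' where y: "y \<in> {0<..<1} \<times> {0<..<1}" "x = coded w ds k y"
    "y' \<in> {0<..<1} \<times> {0<..<1}" "x' = coded w ds k y'"
    using coded by meson
  show "1 / (1 - real M * p) * norm (x - x') \<le> norm (F x - F x')"
    unfolding y(2,4) Fy[OF y(1)] Fy[OF y(3)] using w y(1,3) by (rule expansion_cell)
  fix j assume "j \<le> const_value (rtime k) W"
  then have "j \<le> length w" by (simp add: W const_value_cell[OF w(1)])
  moreover have "baker_comp M a k (k + int j - 1) = baker_iter M a k j"
    by (simp add: baker_comp_def)
  ultimately show "norm (baker_comp M a k (k + int j - 1) x - baker_comp M a k (k + int j - 1) x')
      \<le> norm (F x - F x')"
    unfolding y(2,4) Fy[OF y(1)] Fy[OF y(3)] using baker_iter_dist_le[OF w _ y(1,3)] by simp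
qed

lemma rtime_cells:
  assumes "W \<in> cells k"
  shows "\<exists>n::nat. 2 \<le> n \<and> (\<forall>x\<in>W. rtime k x = ereal (real n))"
proof -
  obtain w ds where w: "W = cell w ds k" "stopping w"
    using assms by (rule cellsE)
  then show ?thesis
    using rtime_cell[OF w(2)] stopping_length[OF w(2)] by (intro exI[of _ "length w"]) blast
qed

end

section \<open>Uniform constants and assembly of the properties\<close>

theorem proposition2p1:
  fixes M :: nat and a_inf a_sup :: real
  assumes "2 \<le> M"
    and "max 0 ((4 * real M * a_sup - 1) / (4 * (real M)\<^sup>2 * a_sup)) < a_inf"
    and "a_inf \<le> a_sup"
    and "a_sup < 1 / (2 * real M)"
  shows "\<exists>lam>1. \<exists>\<delta>>0. \<exists>A>0. \<exists>A'>0.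
    \<forall>a :: int \<Rightarrow> real.
      (\<forall>k. a k \<in> {0 <..< 1 / (2 * real M)}) \<and> (INF k. a k) = a_inf \<and> (SUP k. a k) = a_sup \<longrightarrow>
      (\<exists>(P :: int \<Rightarrow> (real \<times> real) set set) (R :: int \<Rightarrow> real \<times> real \<Rightarrow> ereal).
        \<comment> \<open>(a)\<close>
        (\<forall>k. countable (P k) \<and> P k \<subseteq> sets borel \<and> partition_on (\<Union>(P k)) (P k) \<and>
             \<Union>(P k) \<subseteq> interior unit_square \<and>
             (\<forall>W\<in>P k. 0 < measure square_measure W) \<and>
             measure square_measure (interior unit_square - \<Union>(P k)) = 0) \<and>
        \<comment> \<open>(b)\<close>
        (\<forall>k. (\<forall>x\<in>unit_square. 2 \<le> R k x) \<and>
             (\<forall>W\<in>P k. \<exists>n::nat. 2 \<le> n \<and> (\<forall>x\<in>W. R k x = ereal (real n)))) \<and>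
        \<comment> \<open>(c)\<close>
        (\<forall>k. \<forall>W\<in>P k. let F = baker_comp M a k (k + int (const_value (R k) W) - 1) in
             affine_map_on W F \<and> F ` W = interior unit_square \<and>
             (\<forall>x\<in>W. \<forall>x'\<in>W. norm (F x - F x') \<ge> lam * norm (x - x'))) \<and>
        \<comment> \<open>(d)\<close>
        (\<forall>k. \<forall>W\<in>P k. let F = baker_comp M a k (k + int (const_value (R k) W) - 1) in
             \<forall>x\<in>W. \<forall>x'\<in>W.
               (MAX j\<in>{0..const_value (R k) W}.
                  norm (baker_comp M a k (k + int j - 1) x - baker_comp M a k (k + int j - 1) x'))
               \<le> norm (F x - F x')) \<and>
        \<comment> \<open>(e)\<close>
        (INF k. measure square_measure {x \<in> unit_square. R k x = 2}) \<ge> \<delta> \<and>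
        (INF k. measure square_measure {x \<in> unit_square. R k x = 3}) \<ge> \<delta> \<and>
        \<comment> \<open>(f)\<close>
        (\<forall>k. \<forall>n::nat\<ge>1.
             measure square_measure {x \<in> unit_square. R k x \<ge> ereal (real n)} \<le> A * exp (- A' * real n)))"
proof -
  have M: "0 < real M" and p: "0 < a_inf" using assms(1,2) by auto
  define q where "q = real M * a_sup"
  have "q < 1 / 2" using assms(4) M by (simp add: q_def field_simps)
  moreover have "real M * a_inf \<le> q" using assms(3) M by (simp add: q_def)
  ultimately have Mp: "0 < real M * a_inf" "real M * a_inf < 1" using p M by auto
  \<comment> \<open>This is \<rho> spelled out before any sequence is fixed, so that the constants
    depend only on M and the two bounds.\<close>
  define r where "r = 1 / 2 + 2 * q * (1 - q)"
  have q0: "0 < q" using Mp \<open>real M * a_inf \<le> q\<close> by linarith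
  have "0 < 2 * q * (1 - q)" by (rule mult_pos_pos) (use q0 \<open>q < 1 / 2\<close> in linarith)+
  moreover have "0 < (1 - 2 * q)\<^sup>2" using \<open>q < 1 / 2\<close> by simp
  then have "r < 1" by (simp add: r_def power2_eq_square algebra_simps)
  ultimately have r: "0 < r" "r < 1" unfolding r_def by linarith+
  have pos: "1 < 1 / (1 - real M * a_inf)" "0 < a_inf / 4" "0 < 1 / r\<^sup>2" "0 < - ln r"
    using Mp p r by auto
  have main: "(\<forall>k. countable (P k) \<and> P k \<subseteq> sets borel \<and> partition_on (\<Union>(P k)) (P k) \<and>
         \<Union>(P k) \<subseteq> interior unit_square \<and> (\<forall>W\<in>P k. 0 < measure square_measure W) \<and>
         measure square_measure (interior unit_square - \<Union>(P k)) = 0) \<and>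
      (\<forall>k. (\<forall>x\<in>unit_square. 2 \<le> R k x) \<and>
         (\<forall>W\<in>P k. \<exists>n::nat. 2 \<le> n \<and> (\<forall>x\<in>W. R k x = ereal (real n)))) \<and>
      (\<forall>k. \<forall>W\<in>P k. let F = baker_comp M a k (k + int (const_value (R k) W) - 1) in
         affine_map_on W F \<and> F ` W = interior unit_square \<and>
         (\<forall>x\<in>W. \<forall>x'\<in>W. norm (F x - F x') \<ge> 1 / (1 - real M * a_inf) * norm (x - x'))) \<and>
      (\<forall>k. \<forall>W\<in>P k. let F = baker_comp M a k (k + int (const_value (R k) W) - 1) in
         \<forall>x\<in>W. \<forall>x'\<in>W.
           (MAX j\<in>{0..const_value (R k) W}.
              norm (baker_comp M a k (k + int j - 1) x - baker_comp M a k (k + int j - 1) x'))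
           \<le> norm (F x - F x')) \<and>
      (INF k. measure square_measure {x \<in> unit_square. R k x = 2}) \<ge> a_inf / 4 \<and>
      (INF k. measure square_measure {x \<in> unit_square. R k x = 3}) \<ge> a_inf / 4 \<and>
      (\<forall>k. \<forall>n::nat\<ge>1. measure square_measure {x \<in> unit_square. R k x \<ge> ereal (real n)}
         \<le> 1 / r\<^sup>2 * exp (- (- ln r) * real n))"
    if a: "\<forall>k. a k \<in> {0 <..< 1 / (2 * real M)}" "(INF k. a k) = a_inf" "(SUP k. a k) = a_sup"
      and P: "P = heterochaos.cells M a" and R: "R = heterochaos.rtime M a" for a P R
  proof -
    \<comment> \<open>Boundedness must come first: only then do the real-valued \<open>INF\<close>
      and \<open>SUP\<close> bound every a_k.\<close>
    have "bdd_below (range a)" "bdd_above (range a)"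
      using a(1) unfolding bdd_below_def bdd_above_def by (force intro: less_imp_le)+
    then have bounds: "a_inf \<le> a k" "a k \<le> a_sup" for k
      using a(2,3) cINF_lower[of a UNIV k] cSUP_upper[of k UNIV a] by auto
    interpret heterochaos M a a_inf a_sup
      using assms(1,4) p bounds by unfold_locales
    have \<rho>: "\<rho> = r" by (simp add: \<rho>_def r_def q_def)
    show ?thesis
      unfolding P R Let_def
    proof (intro conjI allI ballI impI)
      fix k
      show "countable (cells k)" by (rule countable_cells)
      show "cells k \<subseteq> sets borel" using open_cells by auto
      show "partition_on (\<Union>(cells k)) (cells k)" by (rule partition_cells)
      show "\<Union>(cells k) \<subseteq> interior unit_square"
        unfolding interior_unit_square using cells_subset by blast
      show "measure square_measure (interior unit_square - \<Union>(cells k)) = 0"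
        by (rule measure_uncovered)
      show "2 \<le> rtime k x" for x by (rule rtime_ge_2)
      show "measure square_measure {x \<in> unit_square. ereal (real n) \<le> rtime k x}
          \<le> 1 / r\<^sup>2 * exp (- (- ln r) * real n)" if "1 \<le> n" for n
        using measure_tail_exp[OF that] unfolding \<rho> .
      fix W assume W: "W \<in> cells k"
      show "0 < measure square_measure W" using W by (rule measure_cells_pos)
      show "\<exists>n::nat. 2 \<le> n \<and> (\<forall>x\<in>W. rtime k x = ereal (real n))" using W by (rule rtime_cells)
      show "affine_map_on W (baker_comp M a k (k + int (const_value (rtime k) W) - 1))"
        "baker_comp M a k (k + int (const_value (rtime k) W) - 1) ` W = interior unit_square"
        using W by (rule cells_return)+
      fix x x' assume x: "x \<in> W" "x' \<in> W"
      show "1 / (1 - real M * a_inf) * norm (x - x')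
          \<le> norm (baker_comp M a k (k + int (const_value (rtime k) W) - 1) x -
              baker_comp M a k (k + int (const_value (rtime k) W) - 1) x')"
        using W x by (rule cells_return)
      show "(MAX j\<in>{0..const_value (rtime k) W}.
            norm (baker_comp M a k (k + int j - 1) x - baker_comp M a k (k + int j - 1) x'))
          \<le> norm (baker_comp M a k (k + int (const_value (rtime k) W) - 1) x -
              baker_comp M a k (k + int (const_value (rtime k) W) - 1) x')"
        using cells_return(4)[OF W x] by (intro Max.boundedI) auto
    next
      show "a_inf / 4 \<le> (INF k. measure square_measure {x \<in> unit_square. rtime k x = 2})"
        by (intro cINF_greatest measure_rtime_2) simp
      show "a_inf / 4 \<le> (INF k. measure square_measure {x \<in> unit_square. rtime k x = 3})"
        by (intro cINF_greatest measure_rtime_3) simp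
    qed
  qed
  show ?thesis
    apply (rule exI[of _ "1 / (1 - real M * a_inf)"], rule conjI[OF pos(1)])
    apply (rule exI[of _ "a_inf / 4"], rule conjI[OF pos(2)])
    apply (rule exI[of _ "1 / r\<^sup>2"], rule conjI[OF pos(3)])
    apply (rule exI[of _ "- ln r"], rule conjI[OF pos(4)])
    apply (intro allI impI)
    apply (elim conjE)
    subgoal for a
      by (rule exI[of _ "heterochaos.cells M a"], rule exI[of _ "heterochaos.rtime M a"])
        (rule main[OF _ _ _ refl refl])
    done
qed

end
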